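(* Let $X$ be a locally compact, locally connected Hausdorff topological space. Then the group $H_2(X)$ of invertible continuous binary operations on $X$ is isomorphic, algebraically and topologically (i.e. via a group isomorphism that is a homeomorphism), to the group $C(X,H(X))$ of continuous maps from $X$ to $H(X)$.
   Context: For topological spaces $Y,Z$, $C(Y,Z)$ is the set of continuous maps $Y\to Z$ with the compact-open topology, generated by the subbase of sets $W(K,U)=\{f: f(K)\subset U\}$, $K\subset Y$ compact, $U\subset Z$ open. $H(X)$ is the group (under composition) of all self-homeomorphisms of $X$, with the compact-open topology (as a subspace of $C(X,X)$). The group operation on $C(X,H(X))$ is pointwise: $(fg)(x)=f(x)\circ g(x)$. A continuous binary operation on $X$ is a continuous map $f:X^2=X\times X\to X$; the set $C_2(X)=C(X^2,X)$ of these carries the compact-open topology and the operation $(f*\varphi)(t,x)=f(t,\varphi(t,x))$ for $t,x\in X$, with identity element $e(t,x)=x$. An element $f\in C_2(X)$ is invertible if there is $\varphi\in C_2(X)$ with $f*\varphi=\varphi*f=e$. $H_2(X)$ is the group (under $*$) of all invertible elements of $C_2(X)$, with the subspace topology. *)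

theory Defs
  imports "HOL-Analysis.Analysis" "HOL-Algebra.Group"
begin

text \<open>
  A map \<open>Y \<rightarrow> Z\<close> between topological spaces is represented by its unique extensional
  representative (undefined outside \<open>topspace Y\<close>), so that equality of elements of a
  function space is equality of maps on \<open>topspace Y\<close>.
\<close>

definition continuous_maps :: "'a topology \<Rightarrow> 'b topology \<Rightarrow> ('a \<Rightarrow> 'b) set" where
  "continuous_maps Y Z = {f \<in> extensional (topspace Y). continuous_map Y Z f}"

definition compact_open_topology :: "'a topology \<Rightarrow> 'b topology \<Rightarrow> ('a \<Rightarrow> 'b) topology" where
  "compact_open_topology Y Z = topology_generated_by
     {{f \<in> continuous_maps Y Z. f ` K \<subseteq> U} | K U. compactin Y K \<and> openin Z U}"

lemma topspace_compact_open_topology [simp]: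
  "topspace (compact_open_topology Y Z) = continuous_maps Y Z"
proof -
  have "continuous_maps Y Z \<in>
      {{f \<in> continuous_maps Y Z. f ` K \<subseteq> U} | K U. compactin Y K \<and> openin Z U}"
    by (intro CollectI exI[of _ "{}"]) auto
  then show ?thesis
    unfolding compact_open_topology_def topology_generated_by_topspace by blast
qed

definition homeo_group :: "'a topology \<Rightarrow> ('a \<Rightarrow> 'a) monoid" where
  "homeo_group X =
     \<lparr>carrier = {f \<in> continuous_maps X X. homeomorphic_map X X f},
      monoid.mult = compose (topspace X),
      one = (\<lambda>x\<in>topspace X. x)\<rparr>"

definition homeo_topology :: "'a topology \<Rightarrow> ('a \<Rightarrow> 'a) topology" where
  "homeo_topology X = subtopology (compact_open_topology X X) (carrier (homeo_group X))"

definition maps_to_homeo_group :: "'a topology \<Rightarrow> ('a \<Rightarrow> 'a \<Rightarrow> 'a) monoid" where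
  "maps_to_homeo_group X =
     \<lparr>carrier = continuous_maps X (homeo_topology X),
      monoid.mult = (\<lambda>f g. \<lambda>x\<in>topspace X. f x \<otimes>\<^bsub>homeo_group X\<^esub> g x),
      one = (\<lambda>x\<in>topspace X. \<one>\<^bsub>homeo_group X\<^esub>)\<rparr>"

definition maps_to_homeo_topology :: "'a topology \<Rightarrow> ('a \<Rightarrow> 'a \<Rightarrow> 'a) topology" where
  "maps_to_homeo_topology X = compact_open_topology X (homeo_topology X)"

definition binop_monoid :: "'a topology \<Rightarrow> ('a \<times> 'a \<Rightarrow> 'a) monoid" where
  "binop_monoid X =
     \<lparr>carrier = continuous_maps (prod_topology X X) X,
      monoid.mult = (\<lambda>f \<phi>. \<lambda>(t, x)\<in>topspace (prod_topology X X). f (t, \<phi> (t, x))),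
      one = (\<lambda>(t, x)\<in>topspace (prod_topology X X). x)\<rparr>"

definition binop_group :: "'a topology \<Rightarrow> ('a \<times> 'a \<Rightarrow> 'a) monoid" where
  "binop_group X = units_of (binop_monoid X)"

definition binop_group_topology :: "'a topology \<Rightarrow> ('a \<times> 'a \<Rightarrow> 'a) topology" where
  "binop_group_topology X =
     subtopology (compact_open_topology (prod_topology X X) X) (carrier (binop_group X))"

lemma topspace_homeo_topology [simp]:
  "topspace (homeo_topology X) = carrier (homeo_group X)"
  by (auto simp: homeo_topology_def homeo_group_def)

lemma topspace_maps_to_homeo_topology [simp]:
  "topspace (maps_to_homeo_topology X) = carrier (maps_to_homeo_group X)"
  by (simp add: maps_to_homeo_topology_def maps_to_homeo_group_def)

lemma topspace_binop_group_topology [simp]: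
  "topspace (binop_group_topology X) = carrier (binop_group X)"
  by (auto simp: binop_group_topology_def binop_group_def units_of_def Units_def binop_monoid_def)

end

theory Submission
  imports Defs
begin

text \<open>
  The isomorphism is currying: it sends a binary operation \<open>f\<close> to the map taking \<open>t\<close> to the
  section \<open>x \<mapsto> f (t, x)\<close>. The product of binary operations is composition of the sections at
  each \<open>t\<close>, so currying is multiplicative, and an inverse of \<open>f\<close> is a continuous operation whose
  sections invert those of \<open>f\<close>.

  Two facts about the compact-open topology carry the topological part. A jointly continuous map
  is continuous into the function space after currying (\<open>continuous_map_curry\<close>, which rests on the
  tube lemma), and the converse holds when the inner factor is locally compact Hausdorff
  (\<open>continuous_map_uncurry\<close>, because then evaluation is continuous). Hence invertible operations
  yield continuous families of homeomorphisms. That currying is continuous in both directions also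
  follows formally: by the same two facts each direction amounts to the joint continuity of an
  evaluation such as \<open>(f, t, x) \<mapsto> f (t, x)\<close>.

  What remains is that every continuous family of homeomorphisms comes from an invertible
  operation, that is, that the inverses \<open>(t, y) \<mapsto> (g t)\<inverse> y\<close> are jointly continuous
  (\<open>continuous_map_inverse_family\<close>). This is in essence Arens' theorem that inversion is continuous
  in the homeomorphism group of a locally compact, locally connected Hausdorff space.
\<close>

section \<open>The exponential law for the compact-open topology\<close>

lemma openin_compact_open_topology:
  assumes "compactin Y K" "openin Z U"
  shows "openin (compact_open_topology Y Z) {f \<in> continuous_maps Y Z. f ` K \<subseteq> U}"
  unfolding compact_open_topology_def using assms by (intro topology_generated_by_Basis) blast

lemma continuous_map_into_compact_open_topology:
  assumes F: "\<And>t. t \<in> topspace T \<Longrightarrow> F t \<in> continuous_maps Y Z"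
    and opn: "\<And>K U. \<lbrakk>compactin Y K; openin Z U\<rbrakk> \<Longrightarrow> openin T {t \<in> topspace T. F t ` K \<subseteq> U}"
  shows "continuous_map T (compact_open_topology Y Z) F"
  unfolding compact_open_topology_def
proof (rule continuous_on_generated_topo)
  fix W assume "W \<in> {{f \<in> continuous_maps Y Z. f ` K \<subseteq> U} |K U. compactin Y K \<and> openin Z U}"
  then obtain K U where W: "W = {f \<in> continuous_maps Y Z. f ` K \<subseteq> U}"
    and "compactin Y K" "openin Z U"
    by blast
  moreover have "F -` W \<inter> topspace T = {t \<in> topspace T. F t ` K \<subseteq> U}"
    using F by (auto simp: W)
  ultimately show "openin T (F -` W \<inter> topspace T)"
    using opn by simp
next
  have "continuous_maps Y Z \<in> {{f \<in> continuous_maps Y Z. f ` K \<subseteq> U} |K U. compactin Y K \<and> openin Z U}"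
    by (intro CollectI exI[of _ "{}"]) auto
  then show "F ` topspace T \<subseteq> \<Union>{{f \<in> continuous_maps Y Z. f ` K \<subseteq> U} |K U. compactin Y K \<and> openin Z U}"
    using F by blast
qed

text \<open>
  If \<open>F t\<close> maps a compact \<open>K\<close> into \<open>U\<close>, then \<open>{t} \<times> K\<close> lies in an open set of pairs that are
  mapped into \<open>U\<close>, and the tube lemma thickens \<open>{t}\<close> to a neighbourhood.
\<close>

lemma continuous_map_curry:
  assumes cont: "continuous_map (prod_topology T Y) Z (\<lambda>(t, y). F t y)"
    and ext: "\<And>t. t \<in> topspace T \<Longrightarrow> F t \<in> extensional (topspace Y)"
  shows "continuous_map T (compact_open_topology Y Z) F"
proof (rule continuous_map_into_compact_open_topology)
  fix t assume t: "t \<in> topspace T"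
  have "continuous_map Y (prod_topology T Y) (Pair t)"
    using t by (simp add: continuous_map_pairwise o_def)
  from continuous_map_compose[OF this cont] have "continuous_map Y Z (F t)"
    by (simp add: o_def)
  then show "F t \<in> continuous_maps Y Z"
    using ext[OF t] by (simp add: continuous_maps_def)
next
  fix K U assume K: "compactin Y K" and U: "openin Z U"
  let ?W = "{p \<in> topspace (prod_topology T Y). (\<lambda>(t, y). F t y) p \<in> U}"
  have W: "openin (prod_topology T Y) ?W"
    using cont U by (rule openin_continuous_map_preimage)
  have KY: "K \<subseteq> topspace Y"
    using K by (rule compactin_subset_topspace)
  show "openin T {t \<in> topspace T. F t ` K \<subseteq> U}"
  proof (subst openin_subopen, intro ballI)
    fix t assume t: "t \<in> {t \<in> topspace T. F t ` K \<subseteq> U}"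
    then have "t \<in> topspace T" "{t} \<times> K \<subseteq> ?W"
      using KY by auto
    from tube_lemma_right[OF W K this]
    obtain A B where AB: "openin T A" "t \<in> A" "K \<subseteq> B" "A \<times> B \<subseteq> ?W"
      by (elim exE conjE) (rule that)
    have "F s y \<in> U" if "s \<in> A" "y \<in> K" for s y
    proof -
      have "(s, y) \<in> ?W"
        using AB(3,4) that by blast
      then show ?thesis
        by simp
    qed
    then have "A \<subseteq> {t \<in> topspace T. F t ` K \<subseteq> U}"
      using openin_subset[OF AB(1)] by blast
    with AB(1,2) show "\<exists>A. openin T A \<and> t \<in> A \<and> A \<subseteq> {t \<in> topspace T. F t ` K \<subseteq> U}"
      by (intro exI conjI)
  qed
qed

text \<open>
  The point \<open>y\<close> has a compact neighbourhood \<open>K\<close> which \<open>f\<close> maps into the given open set \<open>U\<close>.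
  Every map that sends \<open>K\<close> into \<open>U\<close> then sends all points near \<open>y\<close> into \<open>U\<close>, and these maps form
  a subbasic neighbourhood of \<open>f\<close>.
\<close>

lemma continuous_map_evaluation:
  assumes Y: "locally_compact_space Y" "Hausdorff_space Y"
  shows "continuous_map (prod_topology (compact_open_topology Y Z) Y) Z (\<lambda>(f, y). f y)"
  unfolding continuous_map_def
proof (intro conjI allI impI)
  show "(\<lambda>(f, y). f y) \<in> topspace (prod_topology (compact_open_topology Y Z) Y) \<rightarrow> topspace Z"
    by (auto simp: continuous_maps_def dest: continuous_map_funspace)
next
  fix U assume U: "openin Z U"
  let ?P = "{p \<in> topspace (prod_topology (compact_open_topology Y Z) Y). (\<lambda>(f, y). f y) p \<in> U}"
  have base: "neighbourhood_base_of (compactin Y) Y"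
    using Y locally_compact_space_neighbourhood_base by blast
  show "openin (prod_topology (compact_open_topology Y Z) Y) ?P"
    unfolding openin_prod_topology_alt
  proof (intro allI impI)
    fix f y assume "(f, y) \<in> ?P"
    then have f: "f \<in> continuous_maps Y Z" and y: "y \<in> topspace Y" "f y \<in> U"
      by auto
    have "openin Y {y \<in> topspace Y. f y \<in> U}"
      using f U by (auto simp: continuous_maps_def intro: openin_continuous_map_preimage)
    then obtain V K where V: "openin Y V" "compactin Y K" "y \<in> V" "V \<subseteq> K"
        "K \<subseteq> {y \<in> topspace Y. f y \<in> U}"
      using base y unfolding neighbourhood_base_of by (metis (mono_tags, lifting) mem_Collect_eq)
    show "\<exists>A B. openin (compact_open_topology Y Z) A \<and> openin Y B \<and> f \<in> A \<and> y \<in> B \<and> A \<times> B \<subseteq> ?P"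
    proof (intro exI conjI)
      show "openin (compact_open_topology Y Z) {g \<in> continuous_maps Y Z. g ` K \<subseteq> U}"
        using V U by (intro openin_compact_open_topology)
      show "{g \<in> continuous_maps Y Z. g ` K \<subseteq> U} \<times> V \<subseteq> ?P"
        using V by auto
    qed (use V f in auto)
  qed
qed

lemma continuous_map_uncurry:
  assumes Y: "locally_compact_space Y" "Hausdorff_space Y"
    and F: "continuous_map T (compact_open_topology Y Z) F"
  shows "continuous_map (prod_topology T Y) Z (\<lambda>(t, y). F t y)"
proof -
  have "continuous_map (prod_topology T Y) (prod_topology (compact_open_topology Y Z) Y)
      (\<lambda>p. (F (fst p), snd p))"
    using continuous_map_compose[OF continuous_map_fst F]
    by (simp add: continuous_map_pairwise o_def continuous_map_snd)
  from continuous_map_compose[OF this continuous_map_evaluation[OF Y]] show ?thesis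
    by (simp add: o_def case_prod_unfold)
qed

section \<open>Continuity of inversion\<close>

lemma continuous_map_into_homeo_topology:
  "continuous_map T (homeo_topology X) F \<longleftrightarrow>
     continuous_map T (compact_open_topology X X) F \<and>
     (\<forall>t\<in>topspace T. homeomorphic_map X X (F t))"
proof -
  have "F t \<in> continuous_maps X X"
    if "continuous_map T (compact_open_topology X X) F" "t \<in> topspace T" for t
    using continuous_map_funspace[OF that(1)] that(2) by auto
  then show ?thesis
    unfolding homeo_topology_def continuous_map_in_subtopology Pi_iff
    by (simp add: homeo_group_def cong: conj_cong)
qed

text \<open>
  \<open>U\<close> and the complement of \<open>C\<close> are disjoint open sets, and they cover everything off the
  shell \<open>C - U\<close>; a connected set that misses the shell lies in one of the two.
\<close>

lemma connectedin_subset_if_avoids_shell: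
  assumes S: "connectedin X S" and U: "openin X U" and C: "closedin X C" and "U \<subseteq> C"
    and shell: "S \<inter> (C - U) = {}" and meets: "U \<inter> S \<noteq> {}"
  shows "S \<subseteq> U"
proof -
  have "S \<subseteq> topspace X"
    using S by (rule connectedin_subset_topspace)
  then have "S \<subseteq> U \<union> (topspace X - C)"
    using shell by blast
  moreover have "U \<inter> (topspace X - C) \<inter> S = {}"
    using \<open>U \<subseteq> C\<close> by blast
  ultimately have "(topspace X - C) \<inter> S = {}"
    using connectedinD[OF S U, of "topspace X - C"] C meets by blast
  then show ?thesis
    using \<open>S \<subseteq> U \<union> (topspace X - C)\<close> by blast
qed

text \<open>
  This is where local connectedness enters. Let \<open>x\<^sub>0\<close> be the preimage of
  \<open>y\<^sub>0\<close> under \<open>F t\<^sub>0\<close>, and let \<open>V\<close> be a neighbourhood of \<open>x\<^sub>0\<close>. The compact-open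
  topology controls the forward images of compact sets only, so the inverse images have to be
  trapped from outside. Choose \<open>x\<^sub>0 \<in> U \<subseteq> C \<subseteq> V\<close> with \<open>U\<close> open and \<open>C\<close> compact. The shell
  \<open>C - U\<close> is compact and its image at time \<open>t\<^sub>0\<close> misses a small closed neighbourhood \<open>D\<close> of
  \<open>y\<^sub>0\<close>; this persists for \<open>t\<close> near \<open>t\<^sub>0\<close>. Hence for a connected \<open>W \<subseteq> D\<close> the set of preimages
  of \<open>W\<close> at time \<open>t\<close> is connected and misses the shell. If in addition \<open>x\<^sub>0\<close> is mapped into
  \<open>W\<close> at time \<open>t\<close>, then this set meets \<open>U\<close> and therefore stays inside \<open>U \<subseteq> V\<close>.
\<close>

lemma continuous_map_inverse_family:
  assumes X: "locally_compact_space X" "locally_connected_space X" "Hausdorff_space X"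
    and F: "continuous_map T (homeo_topology X) F"
  shows "continuous_map (prod_topology T X) X (\<lambda>(t, y). inv_into (topspace X) (F t) y)"
proof -
  let ?G = "\<lambda>t. inv_into (topspace X) (F t)"
  have co: "continuous_map T (compact_open_topology X X) F"
    and hom: "\<And>t. t \<in> topspace T \<Longrightarrow> homeomorphic_map X X (F t)"
    using F by (auto simp: continuous_map_into_homeo_topology)
  have bij: "bij_betw (F t) (topspace X) (topspace X)" if "t \<in> topspace T" for t
    using hom[OF that] by (simp add: homeomorphic_eq_everything_map bij_betw_def)
  have G: "?G t y \<in> topspace X" "F t (?G t y) = y" if "t \<in> topspace T" "y \<in> topspace X" for t y
    using bij_betw_imp_surj_on[OF bij] that by (auto intro: inv_into_into f_inv_into_f)
  have GF: "?G t (F t x) = x" if "t \<in> topspace T" "x \<in> topspace X" for t x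
    using bij_betw_inv_into_left[OF bij] that by blast
  have opnW: "openin T {t \<in> topspace T. F t ` K \<subseteq> U}" if "compactin X K" "openin X U" for K U
  proof -
    have "{t \<in> topspace T. F t \<in> {f \<in> continuous_maps X X. f ` K \<subseteq> U}} = {t \<in> topspace T. F t ` K \<subseteq> U}"
      using continuous_map_funspace[OF co] by auto
    then show ?thesis
      using openin_continuous_map_preimage[OF co openin_compact_open_topology[OF that]] by simp
  qed
  show ?thesis
    unfolding continuous_map_def
  proof (intro conjI allI impI)
    show "(\<lambda>(t, y). ?G t y) \<in> topspace (prod_topology T X) \<rightarrow> topspace X"
      using G by auto
  next
    fix V assume V: "openin X V"
    let ?P = "{p \<in> topspace (prod_topology T X). (\<lambda>(t, y). ?G t y) p \<in> V}"
    show "openin (prod_topology T X) ?P"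
      unfolding openin_prod_topology_alt
    proof (intro allI impI)
      fix t\<^sub>0 y\<^sub>0 assume "(t\<^sub>0, y\<^sub>0) \<in> ?P"
      then have t0: "t\<^sub>0 \<in> topspace T" and y0: "y\<^sub>0 \<in> topspace X" and "?G t\<^sub>0 y\<^sub>0 \<in> V"
        by auto
      define x\<^sub>0 where "x\<^sub>0 = ?G t\<^sub>0 y\<^sub>0"
      have x0: "x\<^sub>0 \<in> topspace X" "F t\<^sub>0 x\<^sub>0 = y\<^sub>0" "x\<^sub>0 \<in> V"
        using G t0 y0 \<open>?G t\<^sub>0 y\<^sub>0 \<in> V\<close> by (auto simp: x\<^sub>0_def)
      obtain U C where U: "openin X U" "compactin X C" "x\<^sub>0 \<in> U" "U \<subseteq> C" "C \<subseteq> V"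
        using X V x0 locally_compact_space_neighbourhood_base unfolding neighbourhood_base_of by metis
      have C: "closedin X C"
        using X U by (simp add: compactin_imp_closedin)
      have CB: "compactin X (C - U)"
        using U C by (auto intro!: closed_compactin[OF U(2)])
      have "openin X (F t\<^sub>0 ` U)"
        using homeomorphic_imp_open_map[OF hom[OF t0]] U by (simp add: open_map_def)
      moreover have "y\<^sub>0 \<in> F t\<^sub>0 ` U"
        using x0 U by blast
      moreover have "regular_space X"
        using X by (simp add: locally_compact_Hausdorff_imp_regular_space)
      ultimately obtain D' D where D: "openin X D'" "closedin X D" "y\<^sub>0 \<in> D'" "D' \<subseteq> D" "D \<subseteq> F t\<^sub>0 ` U"
        unfolding neighbourhood_base_of_closedin[symmetric] neighbourhood_base_of by metis
      obtain W where W: "openin X W" "connectedin X W" "y\<^sub>0 \<in> W" "W \<subseteq> D'"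
        using X D unfolding locally_connected_space by metis
      \<comment> \<open>For \<open>t \<in> N\<close> the image of the shell misses \<open>W\<close>, and \<open>x\<^sub>0\<close> witnesses that the
        preimage of \<open>W\<close> meets \<open>U\<close>.\<close>
      define N where "N = {t \<in> topspace T. F t ` (C - U) \<subseteq> topspace X - D}
                          \<inter> {t \<in> topspace T. F t ` {x\<^sub>0} \<subseteq> W}"
      have "openin T N"
        unfolding N_def using CB D W x0 by (intro openin_Int opnW) auto
      moreover have "t\<^sub>0 \<in> N"
      proof -
        have "F t\<^sub>0 x \<notin> D" if "x \<in> C - U" for x
        proof
          assume "F t\<^sub>0 x \<in> D"
          then obtain u where "u \<in> U" "F t\<^sub>0 x = F t\<^sub>0 u"
            using D by auto
          moreover have "x \<in> topspace X" "u \<in> topspace X"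
            using that \<open>u \<in> U\<close> U C by (auto dest: closedin_subset openin_subset)
          ultimately have "x = u"
            using GF[OF t0] by metis
          then show False
            using that \<open>u \<in> U\<close> by blast
        qed
        moreover have "F t\<^sub>0 x \<in> topspace X" if "x \<in> C - U" for x
          using that C bij_betwE[OF bij[OF t0]] by (auto dest: closedin_subset)
        ultimately show ?thesis
          using t0 x0 W by (auto simp: N_def)
      qed
      moreover have "N \<times> W \<subseteq> ?P"
      proof (rule subrelI)
        fix t y assume "(t, y) \<in> N \<times> W"
        then have t: "t \<in> N" and y: "y \<in> W"
          by auto
        have tT: "t \<in> topspace T"
          using t by (simp add: N_def)
        have WX: "W \<subseteq> topspace X"
          using W(1) by (rule openin_subset)
        obtain h where h: "homeomorphic_maps X X (F t) h"
          using hom[OF tT] unfolding homeomorphic_map_maps by blast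
        have "h y = ?G t y" if y: "y \<in> topspace X" for y
        proof -
          have "h (F t (?G t y)) = ?G t y"
            using h G(1)[OF tT y] by (simp add: homeomorphic_maps_def)
          then show ?thesis
            by (simp only: G(2)[OF tT y])
        qed
        then have "continuous_map X X (?G t)"
          using h continuous_map_eq[of X X h] by (simp add: homeomorphic_maps_def)
        then have conn: "connectedin X (?G t ` W)"
          using W(2) by (rule connectedin_continuous_map_image)
        have disj: "?G t y \<notin> C - U" if "y \<in> W" for y
        proof
          assume "?G t y \<in> C - U"
          then have "F t (?G t y) \<notin> D"
            using t by (auto simp: N_def)
          then show False
            using that G(2)[OF tT] WX W D by (metis subsetD)
        qed
        have "x\<^sub>0 \<in> ?G t ` W"
          using t GF[OF tT x0(1)] by (force simp: N_def)
        then have "?G t ` W \<subseteq> U"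
          using disj U(3) by (intro connectedin_subset_if_avoids_shell[OF conn U(1) C U(4)]) auto
        then have "?G t y \<in> C"
          using y U(4) by blast
        then show "(t, y) \<in> ?P"
          using U tT y WX by auto
      qed
      ultimately show "\<exists>A B. openin T A \<and> openin X B \<and> t\<^sub>0 \<in> A \<and> y\<^sub>0 \<in> B \<and> A \<times> B \<subseteq> ?P"
        using W by blast
    qed
  qed
qed

section \<open>Invertible binary operations are continuous families of homeomorphisms\<close>

text \<open>
  Both functions are restricted to the underlying space, so that they produce the extensional
  representatives of maps and are mutually inverse on them as functions.
\<close>

definition curried :: "'a topology \<Rightarrow> ('a \<times> 'a \<Rightarrow> 'a) \<Rightarrow> 'a \<Rightarrow> 'a \<Rightarrow> 'a" where
  "curried X f = (\<lambda>t\<in>topspace X. \<lambda>x\<in>topspace X. f (t, x))"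

definition uncurried :: "'a topology \<Rightarrow> ('a \<Rightarrow> 'a \<Rightarrow> 'a) \<Rightarrow> 'a \<times> 'a \<Rightarrow> 'a" where
  "uncurried X g = (\<lambda>(t, x)\<in>topspace (prod_topology X X). g t x)"

lemma uncurried_curried:
  assumes "f \<in> extensional (topspace (prod_topology X X))"
  shows "uncurried X (curried X f) = f"
  by (rule extensionalityI[OF _ assms]) (auto simp: curried_def uncurried_def)

lemma curried_uncurried:
  assumes "g \<in> extensional (topspace X)"
    and "\<And>t. t \<in> topspace X \<Longrightarrow> g t \<in> extensional (topspace X)"
  shows "curried X (uncurried X g) = g"
proof (rule extensionalityI[OF _ assms(1)])
  fix t assume t: "t \<in> topspace X"
  show "curried X (uncurried X g) t = g t"
    by (rule extensionalityI[OF _ assms(2)[OF t]]) (auto simp: t curried_def uncurried_def)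
qed (simp add: curried_def)

lemma monoid_binop_monoid: "monoid (binop_monoid X)"
proof
  fix f g assume "f \<in> carrier (binop_monoid X)" "g \<in> carrier (binop_monoid X)"
  then have f: "continuous_map (prod_topology X X) X f" and g: "continuous_map (prod_topology X X) X g"
    by (auto simp: binop_monoid_def continuous_maps_def)
  have "continuous_map (prod_topology X X) (prod_topology X X) (\<lambda>p. (fst p, g p))"
    using g by (simp add: continuous_map_pairwise o_def continuous_map_fst)
  then have "continuous_map (prod_topology X X) X (\<lambda>p. f (fst p, g p))"
    using continuous_map_compose[OF _ f] by (simp add: o_def)
  then have "continuous_map (prod_topology X X) X
      (\<lambda>(t, x)\<in>topspace (prod_topology X X). f (t, g (t, x)))"
    by (rule continuous_map_eq) auto
  then show "f \<otimes>\<^bsub>binop_monoid X\<^esub> g \<in> carrier (binop_monoid X)"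
    by (simp add: binop_monoid_def continuous_maps_def)
next
  have "continuous_map (prod_topology X X) X (\<lambda>(t, x)\<in>topspace (prod_topology X X). x)"
    by (rule continuous_map_eq[OF continuous_map_snd]) auto
  then show "\<one>\<^bsub>binop_monoid X\<^esub> \<in> carrier (binop_monoid X)"
    by (simp add: binop_monoid_def continuous_maps_def)
qed (auto simp: binop_monoid_def continuous_maps_def fun_eq_iff extensional_def
       dest!: continuous_map_funspace)

text \<open>
  The sections of the inverse operation are continuous inverses of the sections of \<open>f\<close>, so
  the latter are homeomorphisms.
\<close>

lemma continuous_map_curried_unit:
  assumes f: "f \<in> Units (binop_monoid X)"
  shows "continuous_map X (homeo_topology X) (curried X f)"
proof -
  let ?XX = "prod_topology X X"
  obtain \<phi> where "\<phi> \<in> continuous_maps ?XX X" "f \<in> continuous_maps ?XX X"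
    and inv: "\<phi> \<otimes>\<^bsub>binop_monoid X\<^esub> f = \<one>\<^bsub>binop_monoid X\<^esub>"
      "f \<otimes>\<^bsub>binop_monoid X\<^esub> \<phi> = \<one>\<^bsub>binop_monoid X\<^esub>"
    using f by (auto simp: Units_def binop_monoid_def)
  then have cont: "continuous_map ?XX X \<phi>" "continuous_map ?XX X f"
    by (auto simp: continuous_maps_def)
  have inv': "\<phi> (t, f (t, x)) = x" "f (t, \<phi> (t, x)) = x" if "t \<in> topspace X" "x \<in> topspace X" for t x
    using fun_cong[OF inv(1), of "(t, x)"] fun_cong[OF inv(2), of "(t, x)"] that
    by (auto simp: binop_monoid_def)
  have section_cont: "continuous_map X X (\<lambda>x. h (t, x))"
    if "t \<in> topspace X" "continuous_map ?XX X h" for t h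
    using continuous_map_compose[of X ?XX "Pair t" X h] that
    by (simp add: continuous_map_pairwise o_def)
  have "homeomorphic_map X X (curried X f t)" if t: "t \<in> topspace X" for t
  proof -
    have "homeomorphic_maps X X (\<lambda>x. f (t, x)) (\<lambda>x. \<phi> (t, x))"
      unfolding homeomorphic_maps_def using section_cont[OF t] cont inv'[OF t] by auto
    then have "homeomorphic_map X X (\<lambda>x. f (t, x))"
      by (rule homeomorphic_maps_imp_map)
    then show ?thesis
      by (rule homeomorphic_map_eq) (simp add: curried_def t)
  qed
  moreover have "continuous_map X (compact_open_topology X X) (curried X f)"
  proof (rule continuous_map_curry)
    show "continuous_map ?XX X (\<lambda>(t, y). curried X f t y)"
      by (rule continuous_map_eq[OF cont(2)]) (auto simp: curried_def)
  qed (simp add: curried_def)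
  ultimately show ?thesis
    by (simp add: continuous_map_into_homeo_topology)
qed

text \<open>The inverse operation is built from the fibrewise inverses, which are jointly continuous.\<close>

lemma uncurried_homeo_family_unit:
  assumes X: "locally_compact_space X" "locally_connected_space X" "Hausdorff_space X"
    and g: "continuous_map X (homeo_topology X) g"
  shows "uncurried X g \<in> Units (binop_monoid X)"
proof -
  let ?XX = "prod_topology X X" and ?G = "\<lambda>t. inv_into (topspace X) (g t)"
  have co: "continuous_map X (compact_open_topology X X) g"
    and hom: "\<And>t. t \<in> topspace X \<Longrightarrow> homeomorphic_map X X (g t)"
    using g by (auto simp: continuous_map_into_homeo_topology)
  have bij: "bij_betw (g t) (topspace X) (topspace X)" if "t \<in> topspace X" for t
    using hom[OF that] by (simp add: homeomorphic_eq_everything_map bij_betw_def)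
  have gX: "g t x \<in> topspace X" "?G t x \<in> topspace X" "g t (?G t x) = x" "?G t (g t x) = x"
    if "t \<in> topspace X" "x \<in> topspace X" for t x
    using that bij_betwE[OF bij] bij_betwE[OF bij_betw_inv_into[OF bij]]
      bij_betw_inv_into_left[OF bij] bij_betw_inv_into_right[OF bij]
    by blast+
  have "continuous_map ?XX X (uncurried X g)"
    by (rule continuous_map_eq[OF continuous_map_uncurry[OF X(1,3) co]]) (auto simp: uncurried_def)
  moreover have "continuous_map ?XX X (uncurried X ?G)"
    by (rule continuous_map_eq[OF continuous_map_inverse_family[OF X g]]) (auto simp: uncurried_def)
  ultimately have "uncurried X g \<in> carrier (binop_monoid X)" "uncurried X ?G \<in> carrier (binop_monoid X)"
    by (auto simp: binop_monoid_def continuous_maps_def uncurried_def)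
  moreover have "uncurried X g \<otimes>\<^bsub>binop_monoid X\<^esub> uncurried X ?G = \<one>\<^bsub>binop_monoid X\<^esub>"
      "uncurried X ?G \<otimes>\<^bsub>binop_monoid X\<^esub> uncurried X g = \<one>\<^bsub>binop_monoid X\<^esub>"
    using gX by (auto simp: binop_monoid_def uncurried_def fun_eq_iff restrict_def)
  ultimately show ?thesis
    unfolding Units_def by blast
qed

text \<open>
  Continuity of a map into a function space is checked after uncurrying it. For \<open>curried X\<close> this
  leads in two steps to evaluation of a binary operation at a pair, continuous because the
  square of \<open>X\<close> is again locally compact Hausdorff. For \<open>uncurried X\<close> it leads to evaluation
  of a family at \<open>t\<close> followed by evaluation of the resulting homeomorphism at \<open>x\<close>.
\<close>

lemma homeomorphic_maps_curried_uncurried: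
  assumes X: "locally_compact_space X" "locally_connected_space X" "Hausdorff_space X"
  shows "homeomorphic_maps (binop_group_topology X) (maps_to_homeo_topology X)
           (curried X) (uncurried X)"
  unfolding homeomorphic_maps_def
proof (intro conjI ballI)
  let ?XX = "prod_topology X X"
  have XX: "locally_compact_space ?XX" "Hausdorff_space ?XX"
    using X by (simp_all add: locally_compact_space_prod_topology Hausdorff_space_prod_topology)
  have units: "topspace (binop_group_topology X) = Units (binop_monoid X)"
    by (simp add: binop_group_def units_of_carrier)
  show "continuous_map (binop_group_topology X) (maps_to_homeo_topology X) (curried X)"
    unfolding maps_to_homeo_topology_def
  proof (rule continuous_map_curry)
    let ?B = "binop_group_topology X"
    have "continuous_map ?B (compact_open_topology ?XX X) (\<lambda>f. f)"
      unfolding binop_group_topology_def by (simp add: continuous_map_from_subtopology)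
    then have ev: "continuous_map (prod_topology ?B ?XX) X (\<lambda>(f, p). f p)"
      by (rule continuous_map_uncurry[OF XX])
    have "continuous_map (prod_topology (prod_topology ?B X) X) (prod_topology ?B ?XX)
        (\<lambda>q. (fst (fst q), snd (fst q), snd q))"
      by (intro continuous_map_pairedI continuous_map_fst continuous_map_snd
          continuous_map_compose[OF continuous_map_fst, unfolded o_def])
    from continuous_map_compose[OF this ev]
    have "continuous_map (prod_topology (prod_topology ?B X) X) X (\<lambda>(p, y). (\<lambda>(f, t). curried X f t) p y)"
      by (rule continuous_map_eq) (auto simp: curried_def)
    then have "continuous_map (prod_topology ?B X) (compact_open_topology X X) (\<lambda>(f, t). curried X f t)"
      by (rule continuous_map_curry) (auto simp: curried_def)
    then show "continuous_map (prod_topology ?B X) (homeo_topology X) (\<lambda>(f, t). curried X f t)"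
      using continuous_map_curried_unit
      by (auto simp: continuous_map_into_homeo_topology binop_group_def units_of_carrier)
  qed (simp add: curried_def)
  show "continuous_map (maps_to_homeo_topology X) (binop_group_topology X) (uncurried X)"
    unfolding binop_group_topology_def
  proof (rule continuous_map_into_subtopology)
    show "uncurried X \<in> topspace (maps_to_homeo_topology X) \<rightarrow> carrier (binop_group X)"
      using uncurried_homeo_family_unit[OF X]
      by (auto simp: maps_to_homeo_group_def binop_group_def units_of_carrier continuous_maps_def)
    show "continuous_map (maps_to_homeo_topology X) (compact_open_topology ?XX X) (uncurried X)"
    proof (rule continuous_map_curry)
      let ?M = "maps_to_homeo_topology X"
      have "continuous_map (prod_topology ?M X) (homeo_topology X) (\<lambda>(g, t). g t)"
        unfolding maps_to_homeo_topology_def by (rule continuous_map_evaluation[OF X(1,3)])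
      then have "continuous_map (prod_topology ?M X) (compact_open_topology X X) (\<lambda>(g, t). g t)"
        by (simp add: continuous_map_into_homeo_topology)
      then have ev: "continuous_map (prod_topology (prod_topology ?M X) X) X (\<lambda>(p, x). (\<lambda>(g, t). g t) p x)"
        by (rule continuous_map_uncurry[OF X(1,3)])
      have "continuous_map (prod_topology ?M ?XX) (prod_topology (prod_topology ?M X) X)
          (\<lambda>q. ((fst q, fst (snd q)), snd (snd q)))"
        by (intro continuous_map_pairedI continuous_map_fst continuous_map_snd
            continuous_map_compose[OF continuous_map_snd, unfolded o_def])
      from continuous_map_compose[OF this ev]
      show "continuous_map (prod_topology ?M ?XX) X (\<lambda>(g, p). uncurried X g p)"
        by (rule continuous_map_eq) (auto simp: uncurried_def)
    qed (simp add: uncurried_def)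
  qed
next
  fix f assume "f \<in> topspace (binop_group_topology X)"
  then show "uncurried X (curried X f) = f"
    by (intro uncurried_curried)
      (auto simp: binop_group_def units_of_carrier Units_def binop_monoid_def continuous_maps_def)
next
  fix g assume "g \<in> topspace (maps_to_homeo_topology X)"
  then have "g \<in> continuous_maps X (homeo_topology X)"
    by (simp add: maps_to_homeo_group_def)
  then show "curried X (uncurried X g) = g"
    by (intro curried_uncurried)
      (auto simp: continuous_maps_def homeo_group_def dest!: continuous_map_funspace)
qed

lemma curried_mult:
  assumes g: "g \<in> carrier (binop_monoid X)"
  shows "curried X (f \<otimes>\<^bsub>binop_monoid X\<^esub> g) = curried X f \<otimes>\<^bsub>maps_to_homeo_group X\<^esub> curried X g"
proof -
  have "g (t, x) \<in> topspace X" if "t \<in> topspace X" "x \<in> topspace X" for t x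
    using g that by (auto simp: binop_monoid_def continuous_maps_def dest!: continuous_map_funspace)
  then show ?thesis
    by (auto simp: binop_monoid_def maps_to_homeo_group_def homeo_group_def curried_def compose_def
        fun_eq_iff restrict_def)
qed

lemma curried_one: "curried X \<one>\<^bsub>binop_monoid X\<^esub> = \<one>\<^bsub>maps_to_homeo_group X\<^esub>"
  by (auto simp: binop_monoid_def maps_to_homeo_group_def homeo_group_def curried_def
      fun_eq_iff restrict_def)

theorem theorem6:
  fixes X :: "'a topology"
  assumes "locally_compact_space X"
    and "locally_connected_space X"
    and "Hausdorff_space X"
  shows "group (binop_group X) \<and> group (maps_to_homeo_group X) \<and>
    (\<exists>h. h \<in> iso (binop_group X) (maps_to_homeo_group X) \<and>
         homeomorphic_map (binop_group_topology X) (maps_to_homeo_topology X) h)"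
proof -
  have grp: "group (binop_group X)"
    unfolding binop_group_def by (rule monoid.units_group[OF monoid_binop_monoid])
  have homeo: "homeomorphic_map (binop_group_topology X) (maps_to_homeo_topology X) (curried X)"
    using homeomorphic_maps_curried_uncurried[OF assms] by (rule homeomorphic_maps_imp_map)
  then have "bij_betw (curried X) (carrier (binop_group X)) (carrier (maps_to_homeo_group X))"
    by (simp add: homeomorphic_eq_everything_map bij_betw_def)
  moreover from this have "curried X \<in> hom (binop_group X) (maps_to_homeo_group X)"
    by (auto simp: hom_def bij_betwE binop_group_def units_of_carrier units_of_mult
        Units_def intro!: curried_mult)
  ultimately have iso: "curried X \<in> iso (binop_group X) (maps_to_homeo_group X)"
    by (intro isoI)
  \<comment> \<open>The group axioms of the target are transported along the bijective homomorphism.\<close>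
  have "curried X \<one>\<^bsub>binop_group X\<^esub> = \<one>\<^bsub>maps_to_homeo_group X\<^esub>"
    by (simp add: binop_group_def units_of_one curried_one)
  then have "group (maps_to_homeo_group X)"
    using group.iso_imp_img_group[OF grp iso] by simp
  then show ?thesis
    using grp iso homeo by blast
qed

end
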